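(* Let $m,n\ge1$ be integers, $d=m+n$, and let $A$ be a real $m\times n$ matrix. If $A$ is nonsingular, then \[ \sum_{k=1}^{\infty}\Delta_k(A)=\infty. \] Consequently, $\mathcal L^m(\mathrm{Bad}_A)=0$; equivalently, $\mathfrak c_A=0$ $\mathcal L^m$-almost everywhere on $\mathbb T^m$.
   Context: Norms $|\cdot|$ are supremum norms; $\mathbb T^m=\mathbb R^m/\mathbb Z^m$; $|\mathbf x|_{\mathbb Z^m}:=\min_{\mathbf p\in\mathbb Z^m}|\mathbf x-\mathbf p|$; $\mathcal L^m$ is normalized Lebesgue measure on $\mathbb T^m$. $A$ is singular if for every $\varepsilon>0$ and all sufficiently large $Q$ there is $\mathbf q\in\mathbb Z^n$ with $0<|\mathbf q|\le Q$ and $|A\mathbf q|_{\mathbb Z^m}<\varepsilon Q^{-n/m}$. Otherwise $A$ is nonsingular. (Here $A$ is an arbitrary, not necessarily square, matrix; this is not invertibility.) \[ \mathfrak c_A(\mathbf b):=\liminf_{|\mathbf q|\to\infty,\ \mathbf q\in\mathbb Z^n}|\mathbf q|^{n/m}\,|A\mathbf q-\mathbf b|_{\mathbb Z^m}\in[0,+\infty],\qquad \mathrm{Bad}_A:=\{\mathbf b\in\mathbb T^m:\mathfrak c_A(\mathbf b)>0\}. \] Let \[ \Lambda_A=u_A\mathbb Z^d,\quad u_A=\begin{pmatrix}I_m&A\\0&I_n\end{pmatrix},\quad a_t=\begin{pmatrix}e^{t/m}I_m&0\\0&e^{-t/n}I_n\end{pmatrix}, \] and for a lattice $\Lambda\subset\mathbb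 R^d$ and $1\le i\le d$ let $\lambda_i(\Lambda):=\inf\{\rho>0:\Lambda\cap[-\rho,\rho]^d\text{ contains } i\text{ linearly independent vectors}\}$. Define \[ \Delta_k(A):=\prod_{i=1}^{d}\min\{1,\lambda_i(a_{nk\log 2}\Lambda_A)\}. \] *)

theory Defs
  imports "HOL-Analysis.Analysis"
begin

text \<open>The supremum norm is the library's \<^const>\<open>infnorm\<close>. A real \<open>m \<times> n\<close> matrix has
  type \<^typ>\<open>real^'n^'m\<close>, where \<open>m\<close> and \<open>n\<close> are the cardinalities of the index types, and
  \<open>\<real>\<^sup>d\<close> with \<open>d = m + n\<close> is \<^typ>\<open>real^('m + 'n)\<close>.\<close>

definition int_vecs :: "(real^'n) set" where
  "int_vecs = {v. \<forall>i. v $ i \<in> \<int>}"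

text \<open>The infimum is attained, see \<open>dist_int_vecs_attained\<close> below.\<close>

definition dist_int_vecs :: "real^'m \<Rightarrow> real" where
  "dist_int_vecs x = (INF p\<in>int_vecs. infnorm (x - p))"

definition torus_rel :: "real^'m \<Rightarrow> real^'m \<Rightarrow> bool" where
  "torus_rel x y \<longleftrightarrow> x - y \<in> int_vecs"

lemma int_vecs_0: "0 \<in> int_vecs"
  by (simp add: int_vecs_def)

lemma int_vecs_add: "x \<in> int_vecs \<Longrightarrow> y \<in> int_vecs \<Longrightarrow> x + y \<in> int_vecs"
  by (simp add: int_vecs_def)

lemma int_vecs_minus: "x \<in> int_vecs \<Longrightarrow> - x \<in> int_vecs"
  by (simp add: int_vecs_def)

lemma equivp_torus_rel: "equivp torus_rel"
proof (rule equivpI)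
  show "reflp torus_rel"
    by (rule reflpI) (simp add: torus_rel_def int_vecs_0)
  show "symp torus_rel"
  proof (rule sympI)
    fix x y :: "real^'m" assume "torus_rel x y"
    then show "torus_rel y x"
      using int_vecs_minus[of "x - y"] by (simp add: torus_rel_def)
  qed
  show "transp torus_rel"
  proof (rule transpI)
    fix x y z :: "real^'m" assume "torus_rel x y" "torus_rel y z"
    then show "torus_rel x z"
      using int_vecs_add[of "x - y" "y - z"] by (simp add: torus_rel_def)
  qed
qed

quotient_type 'm torus = "real^'m" / torus_rel
  by (rule equivp_torus_rel)

lift_definition to_torus :: "real^'m \<Rightarrow> 'm torus" is "\<lambda>x. x" .

lemma dist_int_vecs_cong:
  assumes "x - y \<in> int_vecs"
  shows "dist_int_vecs x = dist_int_vecs y"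
proof -
  have "(\<lambda>p. infnorm (x - p)) ` int_vecs = (\<lambda>p. infnorm (y - p)) ` int_vecs"
  proof (intro equalityI subsetI)
    fix r assume "r \<in> (\<lambda>p. infnorm (x - p)) ` int_vecs"
    then obtain p where p: "p \<in> int_vecs" "r = infnorm (x - p)" by blast
    have "p + - (x - y) \<in> int_vecs"
      by (intro int_vecs_add int_vecs_minus p assms)
    moreover have "r = infnorm (y - (p + - (x - y)))"
      by (simp add: p)
    ultimately show "r \<in> (\<lambda>p. infnorm (y - p)) ` int_vecs" by blast
  next
    fix r assume "r \<in> (\<lambda>p. infnorm (y - p)) ` int_vecs"
    then obtain p where p: "p \<in> int_vecs" "r = infnorm (y - p)" by blast
    have "p + (x - y) \<in> int_vecs"
      by (intro int_vecs_add p assms)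
    moreover have "r = infnorm (x - (p + (x - y)))"
      by (simp add: p)
    ultimately show "r \<in> (\<lambda>p. infnorm (x - p)) ` int_vecs" by blast
  qed
  then show ?thesis
    by (simp add: dist_int_vecs_def)
qed

lemma infnorm_cart_le: "infnorm (x::real^'m) \<le> r \<longleftrightarrow> (\<forall>i. \<bar>x $ i\<bar> \<le> r)"
proof
  assume "infnorm x \<le> r"
  then show "\<forall>i. \<bar>x $ i\<bar> \<le> r"
    using component_le_infnorm_cart order_trans by blast
next
  assume "\<forall>i. \<bar>x $ i\<bar> \<le> r"
  then show "infnorm x \<le> r"
    unfolding infnorm_cart by (intro cSup_least) auto
qed

lemma dist_int_vecs_attained:
  "\<exists>p\<in>int_vecs. dist_int_vecs x = infnorm (x - p)"
proof -
  define p :: "real^'a" where "p = (\<chi> i. of_int (round (x $ i)))"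
  have p: "p \<in> int_vecs" by (simp add: p_def int_vecs_def)
  have "infnorm (x - p) \<le> infnorm (x - q)" if q: "q \<in> int_vecs" for q
    unfolding infnorm_cart_le
  proof
    fix i
    obtain k where k: "q $ i = of_int k"
      using q by (auto simp: int_vecs_def elim: Ints_cases)
    have "\<bar>(x - p) $ i\<bar> \<le> \<bar>(x - q) $ i\<bar>"
      using round_diff_minimal[of "x $ i" k] by (simp add: p_def k)
    also have "\<dots> \<le> infnorm (x - q)" by (rule component_le_infnorm_cart)
    finally show "\<bar>(x - p) $ i\<bar> \<le> infnorm (x - q)" .
  qed
  with p have "dist_int_vecs x = infnorm (x - p)"
    unfolding dist_int_vecs_def by (intro cInf_eq_minimum) auto
  with p show ?thesis by blast
qed

text \<open>Lebesgue measure on the torus: a set is measurable iff its preimage in \<open>\<real>\<^sup>m\<close> is, and its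
  measure is that of the part of the preimage in the fundamental domain \<open>[0,1)\<^sup>m\<close>.\<close>

definition unit_cell :: "(real^'m) set" where
  "unit_cell = {x. \<forall>i. 0 \<le> x $ i \<and> x $ i < 1}"

definition torus_lebesgue :: "('m::finite) torus measure" where
  "torus_lebesgue = measure_of UNIV {E. to_torus -` E \<in> sets lebesgue}
     (\<lambda>E. emeasure lebesgue (to_torus -` E \<inter> unit_cell))"

lemma unit_cell_measurable: "(unit_cell :: (real^'m) set) \<in> sets borel"
proof -
  have "unit_cell = (\<Inter>i. {x :: real^'m. 0 \<le> x $ i \<and> x $ i < 1})"
    by (auto simp: unit_cell_def)
  also have "\<dots> \<in> sets borel" by measurable
  finally show ?thesis .
qed

lemma sigma_algebra_torus:
  "sigma_algebra UNIV {E. to_torus -` E \<in> sets (lebesgue :: (real^'m) measure)}"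
proof (rule sigma_algebra_iff2[THEN iffD2], intro conjI)
  show "\<forall>s\<in>{E. to_torus -` E \<in> sets (lebesgue :: (real^'m) measure)}.
      UNIV - s \<in> {E. to_torus -` E \<in> sets (lebesgue :: (real^'m) measure)}"
    by (auto simp: vimage_Diff intro: sets.Diff)
qed (auto simp: vimage_UN)

lemma space_torus_lebesgue [simp]: "space torus_lebesgue = UNIV"
  unfolding torus_lebesgue_def by (simp add: space_measure_of)

lemma sets_torus_lebesgue:
  "sets torus_lebesgue = {E. to_torus -` E \<in> sets (lebesgue :: (real^'m) measure)}"
  unfolding torus_lebesgue_def
  by (simp add: sets_measure_of sigma_algebra.sigma_sets_eq[OF sigma_algebra_torus])

lemma emeasure_torus_lebesgue:
  assumes "E \<in> sets (torus_lebesgue :: ('m::finite) torus measure)"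
  shows "emeasure torus_lebesgue E
    = emeasure lebesgue (to_torus -` E \<inter> (unit_cell :: (real^'m) set))"
  unfolding torus_lebesgue_def
proof (rule emeasure_measure_of_sigma[OF sigma_algebra_torus])
  show "positive {E. to_torus -` E \<in> sets lebesgue}
      (\<lambda>E. emeasure lebesgue (to_torus -` E \<inter> (unit_cell :: (real^'m) set)))"
    by (simp add: positive_def)
  show "countably_additive {E. to_torus -` E \<in> sets lebesgue}
      (\<lambda>E. emeasure lebesgue (to_torus -` E \<inter> (unit_cell :: (real^'m) set)))"
  proof (rule countably_additiveI)
    fix F :: "nat \<Rightarrow> 'm torus set"
    assume F: "range F \<subseteq> {E. to_torus -` E \<in> sets (lebesgue :: (real^'m) measure)}"
      and disj: "disjoint_family F"
    have "(\<Sum>i. emeasure lebesgue (to_torus -` F i \<inter> (unit_cell :: (real^'m) set)))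
        = emeasure lebesgue (\<Union>i. to_torus -` F i \<inter> (unit_cell :: (real^'m) set))"
    proof (rule suminf_emeasure)
      show "range (\<lambda>i. to_torus -` F i \<inter> (unit_cell :: (real^'m) set)) \<subseteq> sets lebesgue"
        using F unit_cell_measurable by (auto intro!: sets.Int)
      show "disjoint_family (\<lambda>i. to_torus -` F i \<inter> (unit_cell :: (real^'m) set))"
        using disj unfolding disjoint_family_on_def by blast
    qed
    then show "(\<Sum>i. emeasure lebesgue (to_torus -` F i \<inter> (unit_cell :: (real^'m) set)))
        = emeasure lebesgue (to_torus -` (\<Union>i. F i) \<inter> (unit_cell :: (real^'m) set))"
      by (simp add: vimage_UN)
  qed
  show "E \<in> {E. to_torus -` E \<in> sets (lebesgue :: (real^'m) measure)}"
    using assms by (simp add: sets_torus_lebesgue)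
qed

lemma emeasure_torus_lebesgue_UNIV:
  "emeasure (torus_lebesgue :: ('m::finite) torus measure) UNIV = 1"
proof -
  have sub: "box 0 1 \<subseteq> (unit_cell :: (real^'m) set)" "(unit_cell :: (real^'m) set) \<subseteq> cbox 0 1"
    by (auto simp: unit_cell_def mem_box_cart less_imp_le)
  have one: "1 \<bullet> b = 1" if b: "b \<in> Basis" for b :: "real^'m"
    using b by (auto simp: Basis_vec_def inner_axis)
  have "emeasure lborel (box 0 (1 :: real^'m)) = 1" "emeasure lborel (cbox 0 (1 :: real^'m)) = 1"
    by (simp_all add: emeasure_lborel_box_eq emeasure_lborel_cbox_eq one)
  moreover have "emeasure lborel (box 0 (1 :: real^'m)) \<le> emeasure lborel (unit_cell :: (real^'m) set)"
    "emeasure lborel (unit_cell :: (real^'m) set) \<le> emeasure lborel (cbox 0 (1 :: real^'m))"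
    using sub unit_cell_measurable by (auto intro!: emeasure_mono)
  ultimately have "emeasure lborel (unit_cell :: (real^'m) set) = 1"
    by (metis antisym)
  moreover have "emeasure lebesgue (unit_cell :: (real^'m) set) 
      = emeasure lborel (unit_cell :: (real^'m) set)"
    by (simp add: unit_cell_measurable)
  ultimately show ?thesis
    by (simp add: emeasure_torus_lebesgue sets_torus_lebesgue)
qed

definition singular_matrix :: "real^'n^'m \<Rightarrow> bool" where
  "singular_matrix A \<longleftrightarrow>
     (\<forall>\<epsilon>>0. \<forall>\<^sub>F Q::real in at_top. \<exists>q\<in>int_vecs. 0 < infnorm q \<and> infnorm q \<le> Q \<and>
        dist_int_vecs (A *v q) < \<epsilon> * Q powr (- (real CARD('n) / real CARD('m))))"

text \<open>The filter expresses \<open>|q| \<rightarrow> \<infinity>\<close> along integer vectors \<open>q\<close>. The value depends only on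
  the class of \<open>b\<close> modulo integer vectors and lies in \<open>[0,\<infinity>]\<close>.\<close>

lift_definition inhom_const :: "real^'n^'m \<Rightarrow> 'm torus \<Rightarrow> ennreal" is
  "\<lambda>A b. Liminf (inf (filtercomap infnorm at_top) (principal int_vecs))
     (\<lambda>q. ennreal (infnorm q powr (real CARD('n) / real CARD('m)) * dist_int_vecs (A *v q - b)))"
proof -
  fix A :: "real^'n^'m" and b b' :: "real^'m"
  assume "torus_rel b b'"
  then have "dist_int_vecs (A *v q - b) = dist_int_vecs (A *v q - b')" for q
    by (intro dist_int_vecs_cong) (use int_vecs_minus[of "b - b'"] in \<open>simp add: torus_rel_def\<close>)
  then show "Liminf (inf (filtercomap infnorm at_top) (principal int_vecs))
     (\<lambda>q. ennreal (infnorm q powr (real CARD('n) / real CARD('m)) * dist_int_vecs (A *v q - b)))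
   = Liminf (inf (filtercomap infnorm at_top) (principal int_vecs))
     (\<lambda>q. ennreal (infnorm q powr (real CARD('n) / real CARD('m)) * dist_int_vecs (A *v q - b')))"
    by simp
qed

definition Bad :: "real^'n^'m \<Rightarrow> ('m::finite) torus set" where
  "Bad A = {b. inhom_const A b > 0}"

definition block_matrix ::
    "real^'m^'m \<Rightarrow> real^'n^'m \<Rightarrow> real^'m^'n \<Rightarrow> real^'n^'n \<Rightarrow> real^('m + 'n)^('m + 'n)" where
  "block_matrix P Q R S = (\<chi> i j. case i of
       Inl i' \<Rightarrow> (case j of Inl j' \<Rightarrow> P $ i' $ j' | Inr j' \<Rightarrow> Q $ i' $ j')
     | Inr i' \<Rightarrow> (case j of Inl j' \<Rightarrow> R $ i' $ j' | Inr j' \<Rightarrow> S $ i' $ j'))"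

definition u_mat :: "real^'n^'m \<Rightarrow> real^('m + 'n)^('m + 'n)" where
  "u_mat A = block_matrix (mat 1) A 0 (mat 1)"

definition a_mat :: "real \<Rightarrow> real^('m::finite + 'n::finite)^('m + 'n)" where
  "a_mat t = block_matrix (mat (exp (t / real CARD('m)))) 0 0 (mat (exp (- t / real CARD('n))))"

definition matrix_lattice :: "real^'n^'m \<Rightarrow> (real^('m + 'n)) set" where
  "matrix_lattice A = (\<lambda>v. u_mat A *v v) ` int_vecs"

text \<open>For \<open>1 \<le> i \<le> d\<close> and a lattice \<open>L\<close> in \<open>\<real>\<^sup>d\<close> the set below is nonempty, so the real infimum is
  the intended one; the box is \<open>[-\<rho>,\<rho>]\<^sup>d\<close>.\<close>

definition succ_min :: "nat \<Rightarrow> (real^'d) set \<Rightarrow> real" where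
  "succ_min i L = Inf {\<rho>. \<rho> > 0 \<and>
     (\<exists>S \<subseteq> L \<inter> cbox (vec (- \<rho>)) (vec \<rho>). card S = i \<and> independent S)}"

definition Delta :: "nat \<Rightarrow> real^'n^'m \<Rightarrow> real" where
  "Delta k A = (\<Prod>i = 1..CARD('m) + CARD('n).
     min 1 (succ_min i ((\<lambda>v. a_mat (real CARD('n) * real k * ln 2) *v v) ` matrix_lattice A)))"

end

theory Submission
  imports Defs
begin

text \<open>If \<open>A\<close> is nonsingular, then for infinitely many \<open>k\<close> all nonzero vectors of the lattice
  \<open>a\<^sub>t \<Lambda>\<^sub>A\<close>, \<open>t = n k log 2\<close>, have norm at least a fixed \<open>\<delta>\<close>. For these \<open>k\<close> all factors of
  \<open>\<Delta>\<^sub>k(A)\<close> are bounded below, so the series diverges.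

  At such a scale the lattice vectors of bounded norm span: the box of radius \<open>R\<close> contains of order
  \<open>R\<^sup>d\<close> lattice vectors, whereas a \<open>\<delta>\<close>-separated subset of a hyperplane has only
  \<open>O(R\<^sup>d\<^sup>-\<^sup>1)\<close> points there. Hence the covering radius is bounded, and the points \<open>p + A q\<close> with
  \<open>|q|\<close> comparable to \<open>2\<^sup>k\<close> are \<open>O(2\<^sup>-\<^sup>k\<^sup>n\<^sup>/\<^sup>m)\<close>-dense. Therefore \<open>Bad\<^sub>A\<close> is a countable union of
  closed sets that are porous at every point, and porous sets are null by Vitali's covering theorem.\<close>

subsection \<open>Porous sets\<close>

text \<open>If \<open>S\<close> had positive measure, an open \<open>U\<close> around it could be
  chosen with \<open>U - S\<close> smaller than \<open>c ^ DIM('a)\<close> times the measure of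
  \<open>S\<close>. Disjoint Vitali balls inside \<open>U\<close> cover almost all of
  \<open>S\<close>. Their holes take up the fraction \<open>c ^ DIM('a)\<close> of their total
  measure, yet lie in \<open>U - S\<close>, which is too small for them.\<close>

lemma porous_negligible_lmeasurable:
  fixes S :: "'a::euclidean_space set"
  assumes S: "S \<in> lmeasurable" and c: "0 < c"
    and hole: "\<And>x e. x \<in> S \<Longrightarrow> 0 < e \<Longrightarrow>
      \<exists>r z. 0 < r \<and> r < e \<and> ball z (c * r) \<subseteq> ball x r \<and> ball z (c * r) \<inter> S = {}"
  shows "negligible S"
proof (rule ccontr)
  assume nS: "\<not> negligible S"
  let ?D = "DIM('a)"
  have pos: "0 < measure lebesgue S"
    using S nS measure_nonneg[of lebesgue S] negligible_iff_measure[of S] by linarith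
  obtain U where U: "open U" "S \<subseteq> U" "U - S \<in> lmeasurable"
      "emeasure lebesgue (U - S) < ennreal (c ^ ?D * measure lebesgue S)"
    using sets_lebesgue_outer_open[of S "c ^ ?D * measure lebesgue S"] S pos c by auto
  define K where "K = {(x, r). x \<in> S \<and> 0 < r \<and> ball x r \<subseteq> U \<and>
    (\<exists>z. ball z (c * r) \<subseteq> ball x r \<and> ball z (c * r) \<inter> S = {})}"
  have "\<exists>i. i \<in> K \<and> x \<in> ball (fst i) (snd i) \<and> snd i < e" if x: "x \<in> S" and e: "0 < e" for x e
  proof -
    obtain d where d: "0 < d" "ball x d \<subseteq> U"
      using U x by (meson openE subsetD)
    obtain r z where "0 < r" "r < min d e" "ball z (c * r) \<subseteq> ball x r" "ball z (c * r) \<inter> S = {}"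
      using hole[OF x, of "min d e"] d e by auto
    then show ?thesis
      using x d by (intro exI[of _ "(x, r)"]) (auto simp: K_def)
  qed
  then obtain C where C: "countable C" "C \<subseteq> K"
      "pairwise (\<lambda>i j. disjnt (ball (fst i) (snd i)) (ball (fst j) (snd j))) C"
      "negligible (S - (\<Union>i\<in>C. ball (fst i) (snd i)))"
    using Vitali_covering_theorem_balls[of S K fst snd] by blast
  obtain z where z: "\<And>i. i \<in> C \<Longrightarrow> ball (z i) (c * snd i) \<subseteq> ball (fst i) (snd i)"
      "\<And>i. i \<in> C \<Longrightarrow> ball (z i) (c * snd i) \<inter> S = {}"
  proof -
    have "\<forall>i\<in>C. \<exists>z. ball z (c * snd i) \<subseteq> ball (fst i) (snd i) \<and> ball z (c * snd i) \<inter> S = {}"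
      using C(2) by (auto simp: K_def)
    then show ?thesis using that by metis
  qed
  define H where "H = (\<Union>i\<in>C. ball (z i) (c * snd i))"
  define B where "B = (\<Union>i\<in>C. ball (fst i) (snd i))"
  have r: "0 < snd i" if "i \<in> C" for i using C(2) that by (auto simp: K_def)
  have dB: "disjoint_family_on (\<lambda>i. ball (fst i) (snd i)) C"
    using C(3) by (auto simp: disjoint_family_on_def pairwise_def disjnt_def)
  then have dH: "disjoint_family_on (\<lambda>i. ball (z i) (c * snd i)) C"
    unfolding disjoint_family_on_def using z(1) by blast
  have scale: "emeasure lebesgue (ball y (c * r)) = ennreal (c ^ ?D) * emeasure lebesgue (ball x r)"
    if "0 < r" for x y :: 'a and r
    using c that by (simp add: emeasure_lebesgue_ball_conv_unit_ball[of "c * r" y]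
      emeasure_lebesgue_ball_conv_unit_ball[of r x] power_mult_distrib ennreal_mult mult.assoc
      del: emeasure_completion)
  have "emeasure lebesgue H = (\<integral>\<^sup>+i. emeasure lebesgue (ball (z i) (c * snd i)) \<partial>count_space C)"
    unfolding H_def using C(1) dH by (intro emeasure_UN_countable) auto
  also have "\<dots> = (\<integral>\<^sup>+i. ennreal (c ^ ?D) * emeasure lebesgue (ball (fst i) (snd i)) \<partial>count_space C)"
    using r by (intro nn_integral_cong) (simp add: scale del: emeasure_completion)
  also have "\<dots> = ennreal (c ^ ?D) * (\<integral>\<^sup>+i. emeasure lebesgue (ball (fst i) (snd i)) \<partial>count_space C)"
    by (intro nn_integral_cmult) auto
  also have "(\<integral>\<^sup>+i. emeasure lebesgue (ball (fst i) (snd i)) \<partial>count_space C) = emeasure lebesgue B"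
    unfolding B_def using C(1) dB by (intro emeasure_UN_countable[symmetric]) auto
  finally have HB: "emeasure lebesgue H = ennreal (c ^ ?D) * emeasure lebesgue B" .
  have H_B_sets: "H \<in> sets lebesgue" "B \<in> sets lebesgue"
    by (simp_all add: H_def B_def borel_open open_UN)
  have "emeasure lebesgue S \<le> emeasure lebesgue (B \<union> (S - B))"
    using S H_B_sets by (intro emeasure_mono) auto
  also have "\<dots> = emeasure lebesgue B"
    using C(4) S H_B_sets unfolding B_def[symmetric] negligible_iff_null_sets
    by (intro emeasure_Un_null_set) auto
  finally have SB: "emeasure lebesgue S \<le> emeasure lebesgue B" .
  have "H \<subseteq> U - S"
    using C(2) z unfolding H_def K_def by fastforce
  then have "emeasure lebesgue H \<le> emeasure lebesgue (U - S)"
    using U by (intro emeasure_mono) auto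
  moreover have "ennreal (c ^ ?D * measure lebesgue S) \<le> emeasure lebesgue H"
    using SB S c by (simp add: HB emeasure_eq_measure2 ennreal_mult mult_left_mono)
  ultimately show False
    using U(4) by simp
qed

text \<open>Porosity passes to subsets, so cutting with boxes reduces the claim to finite
  measure.\<close>

lemma porous_negligible:
  fixes S :: "'a::euclidean_space set"
  assumes S: "S \<in> sets lebesgue" and c: "0 < c"
    and hole: "\<And>x e. x \<in> S \<Longrightarrow> 0 < e \<Longrightarrow>
      \<exists>r z. 0 < r \<and> r < e \<and> ball z (c * r) \<subseteq> ball x r \<and> ball z (c * r) \<inter> S = {}"
  shows "negligible S"
proof (subst negligible_on_intervals, intro allI)
  fix a b :: 'a
  show "negligible (S \<inter> cbox a b)"
  proof (rule porous_negligible_lmeasurable[OF _ c])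
    show "S \<inter> cbox a b \<in> lmeasurable"
      using S by (metis Int_commute fmeasurable_Int_fmeasurable lmeasurable_cbox)
    show "\<exists>r z. 0 < r \<and> r < e \<and> ball z (c * r) \<subseteq> ball x r \<and> ball z (c * r) \<inter> (S \<inter> cbox a b) = {}"
      if "x \<in> S \<inter> cbox a b" "0 < e" for x e
      using hole[of x e] that by blast
  qed
qed

subsection \<open>The lattices along the flow\<close>

definition flow_lattice :: "nat \<Rightarrow> real^'n^'m \<Rightarrow> (real^('m::finite + 'n::finite)) set" where
  "flow_lattice k A = (\<lambda>v. a_mat (real CARD('n) * real k * ln 2) *v v) ` matrix_lattice A"

lemma sum_UNIV_Plus: "sum f (UNIV :: ('a::finite + 'b::finite) set) = (\<Sum>i\<in>UNIV. f (Inl i)) + (\<Sum>j\<in>UNIV. f (Inr j))"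
  using sum.Plus[of "UNIV :: 'a set" "UNIV :: 'b set" f] by (simp add: UNIV_Plus_UNIV)

lemma block_matrix_mult_Inl:
  "(block_matrix P Q R S *v v) $ Inl i = (P *v (\<chi> j. v $ Inl j)) $ i + (Q *v (\<chi> j. v $ Inr j)) $ i"
  by (simp add: block_matrix_def matrix_vector_mult_def sum_UNIV_Plus)

lemma block_matrix_mult_Inr:
  "(block_matrix P Q R S *v v) $ Inr i = (R *v (\<chi> j. v $ Inl j)) $ i + (S *v (\<chi> j. v $ Inr j)) $ i"
  by (simp add: block_matrix_def matrix_vector_mult_def sum_UNIV_Plus)

lemma mat_mult_vec: "(mat c *v v) $ i = c * v $ i" for v :: "real^'n"
  by (simp add: mat_def matrix_vector_mult_def if_distrib[where f="\<lambda>x. x * _"] cong: if_cong)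

text \<open>The diagonal entries \<open>e\<^sup>t\<^sup>/\<^sup>m\<close> and \<open>e\<^sup>-\<^sup>t\<^sup>/\<^sup>n\<close> at \<open>t = n k log 2\<close> are \<open>2\<^sup>k\<^sup>n\<^sup>/\<^sup>m\<close> and \<open>2\<^sup>-\<^sup>k\<close>.\<close>

definition flow_point :: "nat \<Rightarrow> real^'n^'m \<Rightarrow> real^'m \<Rightarrow> real^'n \<Rightarrow> real^('m::finite + 'n::finite)" where
  "flow_point k A p q = (\<chi> l. case l of
     Inl i \<Rightarrow> 2 powr (real k * real CARD('n) / real CARD('m)) * (p + A *v q) $ i
   | Inr j \<Rightarrow> q $ j / 2 ^ k)"

lemma flow_point_nth [simp]:
  fixes A :: "real^'n^'m"
  shows "flow_point k A p q $ Inl i = 2 powr (real k * real CARD('n) / real CARD('m)) * (p + A *v q) $ i"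
    and "flow_point k A p q $ Inr j = q $ j / 2 ^ k"
  by (simp_all add: flow_point_def)

lemma flow_point_diff: "flow_point k A p q - flow_point k A p' q' = flow_point k A (p - p') (q - q')"
  by (simp add: vec_eq_iff flow_point_def split: sum.split)
    (simp add: algebra_simps diff_divide_distrib matrix_vector_mult_diff_distrib)

lemma flow_lattice_eq:
  fixes A :: "real^'n^'m"
  shows "flow_lattice k A = {flow_point k A p q | p q. p \<in> int_vecs \<and> q \<in> int_vecs}"
proof -
  let ?t = "real CARD('n) * real k * ln 2"
  have s: "exp (?t / real CARD('m)) = 2 powr (real k * real CARD('n) / real CARD('m))"
    by (simp add: powr_def mult_ac)
  have r: "exp (- (real k * ln 2)) = 1 / 2 ^ k"
    using exp_of_nat_mult[of k "- ln 2 :: real"] by (simp add: exp_minus power_one_over inverse_eq_divide)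
  have *: "a_mat ?t *v (u_mat A *v v) = flow_point k A (\<chi> i. v $ Inl i) (\<chi> j. v $ Inr j)" for v
  proof -
    have "(a_mat ?t *v (u_mat A *v v)) $ l = flow_point k A (\<chi> i. v $ Inl i) (\<chi> j. v $ Inr j) $ l" for l
      by (cases l) (simp_all add: a_mat_def u_mat_def block_matrix_mult_Inl block_matrix_mult_Inr
        mat_mult_vec s r)
    then show ?thesis by (simp add: vec_eq_iff)
  qed
  show ?thesis
  proof (intro set_eqI iffI)
    fix x assume "x \<in> flow_lattice k A"
    then obtain v where "v \<in> int_vecs" "x = a_mat ?t *v (u_mat A *v v)"
      by (auto simp: flow_lattice_def matrix_lattice_def)
    then show "x \<in> {flow_point k A p q | p q. p \<in> int_vecs \<and> q \<in> int_vecs}"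
      unfolding * int_vecs_def by (intro CollectI exI[of _ "\<chi> i. v $ Inl i"] exI[of _ "\<chi> j. v $ Inr j"]) simp
  next
    fix x assume "x \<in> {flow_point k A p q | p q. p \<in> int_vecs \<and> q \<in> int_vecs}"
    then obtain p q where pq: "p \<in> int_vecs" "q \<in> int_vecs" "x = flow_point k A p q" by auto
    define v :: "real^('m + 'n)" where "v = (\<chi> l. case l of Inl i \<Rightarrow> p $ i | Inr j \<Rightarrow> q $ j)"
    have "x = a_mat ?t *v (u_mat A *v v)"
      unfolding * by (simp add: v_def pq)
    moreover have "v \<in> int_vecs"
      using pq by (simp add: v_def int_vecs_def split: sum.split)
    ultimately show "x \<in> flow_lattice k A"
      by (auto simp: flow_lattice_def matrix_lattice_def)
  qed
qed

lemma flow_point_in_lattice: "p \<in> int_vecs \<Longrightarrow> q \<in> int_vecs \<Longrightarrow> flow_point k A p q \<in> flow_lattice k A"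
  by (auto simp: flow_lattice_eq)

lemma flow_lattice_add: "x \<in> flow_lattice k A \<Longrightarrow> y \<in> flow_lattice k A \<Longrightarrow> x + y \<in> flow_lattice k A"
proof -
  assume "x \<in> flow_lattice k A" "y \<in> flow_lattice k A"
  then obtain p q p' q' where *: "p \<in> int_vecs" "q \<in> int_vecs" "x = flow_point k A p q"
    "p' \<in> int_vecs" "q' \<in> int_vecs" "y = flow_point k A p' q'" by (auto simp: flow_lattice_eq)
  have "x + y = flow_point k A (p + p') (q + q')"
    unfolding * by (simp add: vec_eq_iff flow_point_def split: sum.split)
      (simp add: algebra_simps add_divide_distrib matrix_vector_right_distrib)
  with * show ?thesis by (simp add: flow_point_in_lattice int_vecs_add)
qed

lemma flow_lattice_scale: "x \<in> flow_lattice k A \<Longrightarrow> of_int c *\<^sub>R x \<in> flow_lattice k A"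
proof -
  assume "x \<in> flow_lattice k A"
  then obtain p q where *: "p \<in> int_vecs" "q \<in> int_vecs" "x = flow_point k A p q"
    by (auto simp: flow_lattice_eq)
  have "of_int c *\<^sub>R x = flow_point k A (of_int c *\<^sub>R p) (of_int c *\<^sub>R q)"
    unfolding * by (simp add: vec_eq_iff flow_point_def split: sum.split)
      (simp add: algebra_simps matrix_vector_mult_scaleR)
  with * show ?thesis by (simp add: flow_point_in_lattice int_vecs_def)
qed

lemma flow_lattice_sum: "(\<And>x. x \<in> S \<Longrightarrow> f x \<in> flow_lattice k A) \<Longrightarrow> (\<Sum>x\<in>S. f x) \<in> flow_lattice k A"
proof (induction S rule: infinite_finite_induct)
  case (insert x F)
  then show ?case by (simp add: flow_lattice_add)
\<comment> \<open>The empty and the infinite index set both give the sum 0, which is a lattice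
  point.\<close>
qed (use flow_point_in_lattice[OF int_vecs_0 int_vecs_0, of k A] flow_lattice_scale[of _ k A 0] in \<open>simp_all\<close>)

lemma span_flow_lattice:
  fixes A :: "real^'n^'m"
  shows "span (flow_lattice k A) = UNIV"
proof (rule ccontr)
  assume "span (flow_lattice k A) \<noteq> UNIV"
  then obtain v where v: "v \<noteq> 0" "\<And>x. x \<in> flow_lattice k A \<Longrightarrow> v \<bullet> x = 0"
    using span_not_UNIV_orthogonal by (metis span_base)
  have e: "axis i 1 \<in> int_vecs" for i :: "'k::finite"
    by (simp add: int_vecs_def axis_def)
  have l: "v $ Inl i = 0" for i
  proof -
    have "v \<bullet> flow_point k A (axis i 1) 0 = 0"
      by (intro v flow_point_in_lattice e int_vecs_0)
    then show ?thesis
      by (simp add: inner_vec_def sum_UNIV_Plus axis_def if_distrib[where f="\<lambda>x. _ * x"] cong: if_cong)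
  qed
  \<comment> \<open>The test point also has upper coordinates, a scaled column of \<open>A\<close>;
    they drop out because the upper coordinates of \<open>v\<close> are already known to
    vanish.\<close>
  have r: "v $ Inr j = 0" for j
  proof -
    have "v \<bullet> flow_point k A 0 (axis j 1) = 0"
      by (intro v flow_point_in_lattice e int_vecs_0)
    then show ?thesis
      by (simp add: inner_vec_def sum_UNIV_Plus l axis_def if_distrib[where f="\<lambda>x. x / _"] if_distrib[where f="\<lambda>x. _ * x"] cong: if_cong)
  qed
  from l r have "v $ x = 0" for x by (cases x) auto
  with v show False by (simp add: vec_eq_iff)
qed

section \<open>Separated lattices at infinitely many scales and divergence of the series\<close>

lemma dist_int_vecs_le: "p \<in> int_vecs \<Longrightarrow> dist_int_vecs x \<le> infnorm (x - p)"
  unfolding dist_int_vecs_def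
  by (intro cINF_lower bdd_belowI2[of _ 0]) (auto simp: infnorm_pos_le)

lemma int_vecs_infnorm_ge_1:
  assumes "q \<in> int_vecs" "q \<noteq> 0" shows "1 \<le> infnorm (q :: real^'n)"
proof -
  obtain i where i: "q $ i \<noteq> 0" using assms by (auto simp: vec_eq_iff)
  obtain c where c: "q $ i = of_int c" using assms by (auto simp: int_vecs_def elim: Ints_cases)
  have "1 \<le> \<bar>c\<bar>" using i c by auto
  then have "1 \<le> \<bar>q $ i\<bar>" unfolding c by linarith
  also have "\<dots> \<le> infnorm q" by (rule component_le_infnorm_cart)
  finally show ?thesis .
qed

lemma infnorm_flow_point_ge:
  fixes A :: "real^'n^'m"
  shows "2 powr (real k * real CARD('n) / real CARD('m)) * infnorm (p + A *v q) \<le> infnorm (flow_point k A p q)"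
    and "infnorm q / 2 ^ k \<le> infnorm (flow_point k A p q)"
proof -
  let ?s = "2 powr (real k * real CARD('n) / real CARD('m))"
  have "\<bar>(p + A *v q) $ i\<bar> \<le> infnorm (flow_point k A p q) / ?s" for i
    using component_le_infnorm_cart[of "flow_point k A p q" "Inl i"]
    by (simp add: abs_mult pos_le_divide_eq mult.commute)
  then have "infnorm (p + A *v q) \<le> infnorm (flow_point k A p q) / ?s"
    using infnorm_cart_le by blast
  then show "?s * infnorm (p + A *v q) \<le> infnorm (flow_point k A p q)"
    by (simp add: field_simps)
  have "\<bar>q $ i\<bar> \<le> infnorm (flow_point k A p q) * 2 ^ k" for i
    using component_le_infnorm_cart[of "flow_point k A p q" "Inr i"] by (simp add: field_simps)
  then have "infnorm q \<le> infnorm (flow_point k A p q) * 2 ^ k"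
    using infnorm_cart_le by blast
  then show "infnorm q / 2 ^ k \<le> infnorm (flow_point k A p q)"
    by (simp add: field_simps)
qed

text \<open>Dani correspondence. Nonsingularity yields arbitrarily large \<open>Q\<close> for which
  no nonzero \<open>q\<close> with \<open>infnorm q \<le> Q\<close> is approximated too well. At the
  scale \<open>2 ^ k \<le> Q < 2 ^ (k + 1)\<close> a nonzero lattice vector is then long: by its
  integral part \<open>p\<close> if \<open>q = 0\<close>, by its lower block if
  \<open>infnorm q > Q\<close>, and by its upper block otherwise.\<close>

lemma nonsingular_frequently_separated:
  fixes A :: "real^'n^'m"
  assumes "\<not> singular_matrix A"
  obtains \<delta> where "0 < \<delta>"
    "\<exists>\<^sub>F k in sequentially. \<forall>x\<in>flow_lattice k A. x \<noteq> 0 \<longrightarrow> \<delta> \<le> infnorm x"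
proof -
  let ?e = "real CARD('n) / real CARD('m)"
  obtain \<epsilon> where e: "0 < \<epsilon>" and freq: "\<exists>\<^sub>F Q in at_top. \<forall>q\<in>int_vecs. 0 < infnorm q \<longrightarrow>
      infnorm q \<le> Q \<longrightarrow> \<epsilon> * Q powr (- ?e) \<le> dist_int_vecs (A *v q)"
    using assms unfolding singular_matrix_def by (force simp: frequently_def not_less not_le)
  \<comment> \<open>The factor \<open>2 powr (- ?e)\<close> pays for rounding \<open>Q\<close> down
    to a power of two; the bound 1 serves the cases \<open>q = 0\<close> and
    \<open>infnorm q > Q\<close>.\<close>
  define \<delta> where "\<delta> = min 1 (\<epsilon> * 2 powr (- ?e))"
  have "\<exists>k\<ge>k0. \<forall>x\<in>flow_lattice k A. x \<noteq> 0 \<longrightarrow> \<delta> \<le> infnorm x" for k0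
  proof -
    obtain Q where Q: "2 ^ k0 \<le> Q" and sep: "\<And>q. q\<in>int_vecs \<Longrightarrow> 0 < infnorm q \<Longrightarrow>
        infnorm q \<le> Q \<Longrightarrow> \<epsilon> * Q powr (- ?e) \<le> dist_int_vecs (A *v q)"
      using freq unfolding frequently_def eventually_at_top_linorder by meson
    have "Q > 0" using Q by (meson less_le_trans zero_less_numeral zero_less_power)
    have "1 \<le> Q" using Q by (meson one_le_numeral one_le_power order_trans)
    define k where "k = nat \<lfloor>log 2 Q\<rfloor>"
    have l: "real k \<le> log 2 Q" "log 2 Q < real k + 1"
      using \<open>1 \<le> Q\<close> by (auto simp: k_def)
    have kQ: "2 ^ k \<le> Q" "Q \<le> 2 powr (real k + 1)"
      using l \<open>Q > 0\<close> by (simp_all add: le_log_iff log_less_iff less_imp_le flip: powr_realpow)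
    have "real k0 \<le> log 2 Q"
      using Q \<open>Q > 0\<close> by (simp add: le_log_iff powr_realpow)
    then have "k0 \<le> k" unfolding k_def by (simp add: le_nat_iff le_floor_iff)
    have "\<delta> \<le> infnorm x" if x: "x \<in> flow_lattice k A" "x \<noteq> 0" for x
    proof -
      obtain p q where pq: "p \<in> int_vecs" "q \<in> int_vecs" "x = flow_point k A p q"
        using x by (auto simp: flow_lattice_eq)
      let ?s = "2 powr (real k * real CARD('n) / real CARD('m))"
      note ge = infnorm_flow_point_ge[where k=k and A=A and p=p and q=q, folded pq(3)]
      consider "q = 0" | "q \<noteq> 0" "Q < infnorm q" | "q \<noteq> 0" "infnorm q \<le> Q" by linarith
      then show ?thesis
      proof cases
        case 1
        have "flow_point k A 0 0 = 0" by (simp add: vec_eq_iff flow_point_def split: sum.split)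
        with 1 x pq have "p \<noteq> 0" by metis
        then have "1 * 1 \<le> ?s * infnorm p"
          using pq by (intro mult_mono int_vecs_infnorm_ge_1) (auto intro!: ge_one_powr_ge_zero)
        with ge(1) 1 show ?thesis by (simp add: \<delta>_def)
      next
        case 2
        then have "1 \<le> infnorm q / 2 ^ k" using kQ by (simp add: field_simps)
        with ge(2) show ?thesis unfolding \<delta>_def by linarith
      next
        case 3
        then have "\<epsilon> * Q powr (- ?e) \<le> dist_int_vecs (A *v q)"
          using pq infnorm_pos_lt[of q] by (intro sep) auto
        also have "\<dots> \<le> infnorm (p + A *v q)"
          using dist_int_vecs_le[of "- p" "A *v q"] int_vecs_minus[OF pq(1)] by (simp add: add.commute)
        finally have "?s * (\<epsilon> * Q powr (- ?e)) \<le> infnorm x"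
          using ge(1) by (meson mult_left_mono order_trans powr_ge_zero)
        moreover have "\<epsilon> * 2 powr (- ?e) \<le> ?s * (\<epsilon> * Q powr (- ?e))"
        proof -
          have "?s * 2 powr ((real k + 1) * (- ?e)) = 2 powr (- ?e)"
            unfolding powr_add[symmetric] by (simp add: field_simps)
          moreover have "?s * 2 powr ((real k + 1) * (- ?e)) \<le> ?s * Q powr (- ?e)"
            using powr_mono2'[of "- ?e" Q "2 powr (real k + 1)"] kQ \<open>Q > 0\<close> by (simp add: powr_powr)
          ultimately have "2 powr (- ?e) \<le> ?s * Q powr (- ?e)" by linarith
          then have "\<epsilon> * 2 powr (- ?e) \<le> \<epsilon> * (?s * Q powr (- ?e))"
            using e by (intro mult_left_mono) auto
          then show ?thesis by (simp only: mult.left_commute)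
        qed
        ultimately show ?thesis by (simp add: \<delta>_def)
      qed
    qed
    with \<open>k0 \<le> k\<close> show ?thesis by blast
  qed
  moreover have "0 < \<delta>" using e by (simp add: \<delta>_def)
  ultimately show ?thesis
    using that unfolding frequently_sequentially by blast
qed

text \<open>A box admissible for \<open>i \<ge> 1\<close> contains a nonzero lattice vector, so its
  radius is at least \<open>\<delta>\<close>. The spanning hypothesis makes the set of admissible
  radii nonempty, without which the real infimum would say nothing.\<close>

lemma succ_min_ge:
  fixes L :: "(real^'d) set"
  assumes L: "\<And>x. x \<in> L \<Longrightarrow> x \<noteq> 0 \<Longrightarrow> \<delta> \<le> infnorm x" and sp: "span L = UNIV"
    and i: "1 \<le> i" "i \<le> CARD('d)"
  shows "\<delta> \<le> succ_min i L"
  unfolding succ_min_def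
proof (rule cInf_greatest)
  have box: "x \<in> cbox (vec (- \<rho>)) (vec \<rho>) \<longleftrightarrow> infnorm x \<le> \<rho>" for x :: "real^'d" and \<rho>
    by (auto simp: infnorm_cart_le mem_box_cart abs_le_iff minus_le_iff)
  obtain B where B: "B \<subseteq> L" "independent B" "L \<subseteq> span B"
    using maximal_independent_subset by blast
  then have "span B = UNIV" using sp by (metis span_mono span_span top.extremum_unique)
  then have "card B = CARD('d)"
    using B(2) by (metis dim_UNIV dim_span_eq_card_independent DIM_cart DIM_real mult.right_neutral)
  moreover have "finite B" using B(2) by (rule finiteI_independent)
  ultimately obtain S where S: "S \<subseteq> B" "card S = i"
    using i by (metis obtain_subset_with_card_n)
  have "finite S" using S \<open>finite B\<close> finite_subset by blast
  define \<rho> where "\<rho> = 1 + (\<Sum>x\<in>S. infnorm x)"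
  have "infnorm x \<le> \<rho>" if "x \<in> S" for x
    using member_le_sum[of x S infnorm] that \<open>finite S\<close> by (simp add: \<rho>_def infnorm_pos_le)
  moreover have "\<rho> > 0" by (simp add: \<rho>_def sum_nonneg infnorm_pos_le add_pos_nonneg)
  moreover have "independent S" using B S independent_mono by blast
  ultimately have "\<rho> \<in> {\<rho>. \<rho> > 0 \<and> (\<exists>S \<subseteq> L \<inter> cbox (vec (- \<rho>)) (vec \<rho>). card S = i \<and> independent S)}"
    using S B unfolding box[abs_def] by (auto intro!: exI[of _ S] simp: box)
  then show "{\<rho>. \<rho> > 0 \<and> (\<exists>S \<subseteq> L \<inter> cbox (vec (- \<rho>)) (vec \<rho>). card S = i \<and> independent S)} \<noteq> {}"
    by blast
  fix \<rho> assume "\<rho> \<in> {\<rho>. \<rho> > 0 \<and> (\<exists>S \<subseteq> L \<inter> cbox (vec (- \<rho>)) (vec \<rho>). card S = i \<and> independent S)}"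
  then obtain S where S: "S \<subseteq> L \<inter> cbox (vec (- \<rho>)) (vec \<rho>)" "card S = i" "independent S" by blast
  then obtain x where "x \<in> S" using i by (metis card.empty ex_in_conv not_one_le_zero)
  with S have "x \<noteq> 0" using dependent_zero by blast
  then have "\<delta> \<le> infnorm x" using L S \<open>x \<in> S\<close> by blast
  also have "\<dots> \<le> \<rho>" using S \<open>x \<in> S\<close> box by blast
  finally show "\<delta> \<le> \<rho>" .
qed

lemma Delta_ge:
  fixes A :: "real^'n^'m"
  assumes "\<forall>x\<in>flow_lattice k A. x \<noteq> 0 \<longrightarrow> \<delta> \<le> infnorm x" "0 < \<delta>"
  shows "min 1 \<delta> ^ (CARD('m) + CARD('n)) \<le> Delta k A"
proof -
  have "(\<Prod>i = 1..CARD('m) + CARD('n). min 1 \<delta>) \<le> Delta k A"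
    unfolding Delta_def flow_lattice_def[symmetric]
  proof (intro prod_mono conjI)
    fix i assume "i \<in> {1..CARD('m) + CARD('n)}"
    then have "\<delta> \<le> succ_min i (flow_lattice k A)"
      using assms by (intro succ_min_ge span_flow_lattice) (auto simp: card_UNIV_sum)
    then show "min 1 \<delta> \<le> min 1 (succ_min i (flow_lattice k A))" by simp
  qed (use assms in simp)
  then show ?thesis by simp
qed

lemma sum_Delta_infinite:
  fixes A :: "real^'n^'m"
  assumes "\<not> singular_matrix A"
  shows "(\<Sum>k. ennreal (Delta (Suc k) A)) = \<infinity>"
proof -
  obtain \<delta> where d: "0 < \<delta>"
    "\<exists>\<^sub>F k in sequentially. \<forall>x\<in>flow_lattice k A. x \<noteq> 0 \<longrightarrow> \<delta> \<le> infnorm x"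
    using nonsingular_frequently_separated[OF assms] .
  define c where "c = min 1 \<delta> ^ (CARD('m) + CARD('n))"
  have "0 < c" using d by (simp add: c_def)
  have freq: "\<exists>\<^sub>F k in sequentially. c \<le> Delta k A"
    using d(2) unfolding c_def by (rule frequently_elim1) (use Delta_ge d(1) in blast)
  \<comment> \<open>This is \<open>succ_min_ge\<close> with separation constant 0. Nonnegative terms
    are needed to turn a finite sum in \<open>ennreal\<close> into real summability.\<close>
  have succ_min_nonneg: "0 \<le> succ_min i (flow_lattice k A)" if "1 \<le> i" "i \<le> CARD('m + 'n)" for i k
    using that by (intro succ_min_ge span_flow_lattice infnorm_pos_le)
  then have Delta_nonneg: "0 \<le> Delta k A" for k
    unfolding Delta_def flow_lattice_def[symmetric] by (intro prod_nonneg) (auto simp: card_UNIV_sum)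
  show ?thesis
  proof (rule ccontr)
    assume "(\<Sum>k. ennreal (Delta (Suc k) A)) \<noteq> \<infinity>"
    then have "summable (\<lambda>k. Delta (Suc k) A)"
      using Delta_nonneg by (intro summable_suminf_not_top) auto
    then have "(\<lambda>k. Delta k A) \<longlonglongrightarrow> 0"
      using summable_LIMSEQ_zero summable_Suc_iff by blast
    then have "\<forall>\<^sub>F k in sequentially. Delta k A < c"
      using \<open>0 < c\<close> order_tendstoD(2) by blast
    with freq show False
      unfolding frequently_def by (simp add: not_le)
  qed
qed

subsection \<open>Bounded covering radius\<close>

text \<open>Pigeonhole count. Suppose all short lattice vectors are orthogonal to \<open>v\<close>.
  About \<open>(R * 2 ^ k) ^ n\<close> lattice points lie in a box with \<open>m\<close> sides
  \<open>s\<close> and \<open>n\<close> sides \<open>R\<close>. Cut it into cells of side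
  \<open>R\<close>: points of one cell differ by short vectors, hence lie in a translate of a
  hyperplane, where separation permits only \<open>O(R ^ (d - 1))\<close> of them. As
  \<open>s ^ m = 2 ^ (k * n)\<close>, comparing the counts bounds \<open>R\<close>.\<close>

lemma span_small_flow_lattice:
  fixes A :: "real^'n^'m" and D R :: nat
  defines "d \<equiv> CARD('m) + CARD('n)"
  assumes sep: "\<forall>x\<in>flow_lattice k A. x \<noteq> 0 \<longrightarrow> \<delta> \<le> infnorm x"
    and D: "0 < D" "real d \<le> real D * \<delta>"
    and R: "2 ^ CARD('m) * (3 * D) ^ (d - 1) < R"
    and k: "real R \<le> 2 powr (real k * real CARD('n) / real CARD('m))"
  shows "span {x \<in> flow_lattice k A. infnorm x \<le> real R} = UNIV"
proof (rule ccontr)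
  assume "span {x \<in> flow_lattice k A. infnorm x \<le> real R} \<noteq> UNIV"
  then obtain v where v: "v \<noteq> 0" "\<And>x. x \<in> flow_lattice k A \<Longrightarrow> infnorm x \<le> real R \<Longrightarrow> v \<bullet> x = 0"
    using span_not_UNIV_orthogonal by (metis (mono_tags, lifting) mem_Collect_eq span_base)
  have card_mn: "CARD('m + 'n) = d" by (simp add: d_def card_UNIV_sum)
  have d2: "2 \<le> d" unfolding d_def
    using zero_less_card_finite[where 'a='m] zero_less_card_finite[where 'a='n] by linarith
  have "0 < R" using R by simp
  define s where "s = 2 powr (real k * real CARD('n) / real CARD('m))"
  have s: "0 < s" "real R \<le> s" using k by (simp_all add: s_def)
  \<comment> \<open>In a vector orthogonal to \<open>v\<close>, the coordinate where
    \<open>v\<close> is largest in absolute value is controlled by the remaining ones.\<close>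
  obtain i where i: "\<And>j. \<bar>v $ j\<bar> \<le> \<bar>v $ i\<bar>"
  proof -
    have "Max (range (\<lambda>j. \<bar>v $ j\<bar>)) \<in> range (\<lambda>j. \<bar>v $ j\<bar>)" by (intro Max_in) auto
    then obtain i where "Max (range (\<lambda>j. \<bar>v $ j\<bar>)) = \<bar>v $ i\<bar>" by blast
    then show ?thesis using that[of i] by (metis Max_ge finite finite_imageI rangeI)
  qed
  have vi: "0 < \<bar>v $ i\<bar>"
  proof (rule ccontr)
    assume "\<not> 0 < \<bar>v $ i\<bar>"
    then have "v $ j = 0" for j using i[of j] by linarith
    with v(1) show False by (simp add: vec_eq_iff)
  qed

  define N where "N = R * 2 ^ k"
  define M where "M = nat \<lfloor>s / real R\<rfloor>"
  define T where "T = (UNIV :: 'n set) \<rightarrow>\<^sub>E {..N}"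
  define q :: "('n \<Rightarrow> nat) \<Rightarrow> real^'n" where "q f = (\<chi> j. real (f j))" for f
  \<comment> \<open>The choice of \<open>p\<close> reduces \<open>A *v q f\<close> modulo 1, so the
    upper coordinates of \<open>X f\<close> lie between 0 and \<open>s\<close>; for \<open>f\<close>
    in \<open>T\<close> the lower ones lie between 0 and \<open>R\<close>.\<close>
  define X where "X f = flow_point k A (\<chi> j. - of_int \<lfloor>(A *v q f) $ j\<rfloor>) (q f)" for f
  define cell where "cell f = (\<lambda>j\<in>UNIV. nat \<lfloor>X f $ Inl j / real R\<rfloor>)" for f
  define C where "C = (UNIV :: 'm set) \<rightarrow>\<^sub>E {..M}"
  define G where "G = (2 * R * D + 1) ^ (d - 1)"
  have XInl: "X f $ Inl j = s * frac ((A *v q f) $ j)" for f j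
    by (simp add: X_def s_def frac_def)
  have XInr: "X f $ Inr j = real (f j) / 2 ^ k" for f j
    by (simp add: X_def q_def)
  have X_diff: "X f - X f' \<in> flow_lattice k A" for f f'
    unfolding X_def flow_point_diff by (intro flow_point_in_lattice) (auto simp: int_vecs_def q_def)
  have cell_mem: "cell f \<in> C" for f
  proof -
    have "X f $ Inl j / real R \<le> s / real R" for j
      using s frac_lt_1[of "(A *v q f) $ j"] \<open>0 < R\<close> unfolding XInl
      by (intro divide_right_mono) (simp_all add: mult_left_le less_imp_le)
    then show ?thesis
      by (auto simp: cell_def C_def M_def intro!: nat_mono floor_mono)
  qed
  have small: "infnorm (X f - X f') \<le> real R" if f: "f \<in> T" "f' \<in> T" "cell f = cell f'" for f f'
    unfolding infnorm_cart_le
  proof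
    fix l :: "'m + 'n"
    show "\<bar>(X f - X f') $ l\<bar> \<le> real R"
    proof (cases l)
      case (Inl j)
      have "nat \<lfloor>X f $ Inl j / real R\<rfloor> = nat \<lfloor>X f' $ Inl j / real R\<rfloor>"
        using fun_cong[OF f(3), of j] by (simp add: cell_def)
      moreover have "0 \<le> X g $ Inl j / real R" for g
        using s by (simp add: XInl)
      ultimately have "\<lfloor>X f $ Inl j / real R\<rfloor> = \<lfloor>X f' $ Inl j / real R\<rfloor>"
        by (metis eq_nat_nat_iff zero_le_floor)
      then have "\<bar>X f $ Inl j / real R - X f' $ Inl j / real R\<bar> \<le> 1" by linarith
      then have "\<bar>X f $ Inl j - X f' $ Inl j\<bar> / real R \<le> 1"
        by (simp flip: diff_divide_distrib)
      then show ?thesis using Inl \<open>0 < R\<close> by (simp add: field_simps)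
    next
      case (Inr j)
      have "0 \<le> X g $ Inr j \<and> X g $ Inr j \<le> real R" if "g \<in> T" for g
      proof -
        have "g j \<le> R * 2 ^ k" using that by (auto simp: T_def N_def PiE_iff)
        then have "real (g j) \<le> real (R * 2 ^ k)" by (rule of_nat_mono)
        then show ?thesis by (simp add: XInr divide_le_eq)
      qed
      from this[OF f(1)] this[OF f(2)] show ?thesis
        unfolding Inr vector_minus_component by linarith
    qed
  qed
  have fibre: "card {f \<in> T. cell f = c} \<le> G" for c
  proof (cases "{f \<in> T. cell f = c} = {}")
    case False
    then obtain f0 where f0: "f0 \<in> T" "cell f0 = c" by blast
    \<comment> \<open>Grid labels of mesh \<open>1 / D\<close> in all coordinates but
      \<open>i\<close>. Measuring from the base point \<open>X f0\<close> of the same cell keeps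
      each label between \<open>- R * D\<close> and \<open>R * D\<close>, which leaves
      \<open>G\<close> label vectors.\<close>
    define g where "g f = (\<lambda>j\<in>UNIV - {i}. \<lfloor>real D * (X f - X f0) $ j\<rfloor>)" for f
    have "card {f \<in> T. cell f = c} \<le> card ((UNIV - {i}) \<rightarrow>\<^sub>E {- int (R * D)..int (R * D)})"
    proof (rule card_inj_on_le)
      show "finite ((UNIV - {i}) \<rightarrow>\<^sub>E {- int (R * D)..int (R * D)})"
        by (intro finite_PiE) auto
      show "g ` {f \<in> T. cell f = c} \<subseteq> (UNIV - {i}) \<rightarrow>\<^sub>E {- int (R * D)..int (R * D)}"
      proof (rule image_subsetI)
        fix f assume f: "f \<in> {f \<in> T. cell f = c}"
        have "\<lfloor>real D * (X f - X f0) $ j\<rfloor> \<in> {- int (R * D)..int (R * D)}" for j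
        proof -
          have "infnorm (X f - X f0) \<le> real R"
            using f f0 by (intro small) auto
          then have "\<bar>(X f - X f0) $ j\<bar> \<le> real R"
            using component_le_infnorm_cart[of "X f - X f0" j] by linarith
          then have "\<bar>real D * (X f - X f0) $ j\<bar> \<le> real D * real R"
            unfolding abs_mult by (intro mult_mono) auto
          then show ?thesis
            unfolding atLeastAtMost_iff le_floor_iff floor_le_iff by (simp add: abs_le_iff mult.commute)
        qed
        then show "g f \<in> (UNIV - {i}) \<rightarrow>\<^sub>E {- int (R * D)..int (R * D)}"
          unfolding g_def by simp
      qed
      show "inj_on g {f \<in> T. cell f = c}"
      proof (rule inj_onI)
        fix f f' assume "f \<in> {f \<in> T. cell f = c}" "f' \<in> {f \<in> T. cell f = c}" and g_eq: "g f = g f'"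
        then have f: "f \<in> T" "f' \<in> T" "cell f = cell f'" by auto
        define z where "z = X f - X f'"
        have "v \<bullet> z = 0"
          unfolding z_def using f by (intro v X_diff small) auto
        have zj: "\<bar>z $ j\<bar> \<le> 1 / real D" if "j \<noteq> i" for j
        proof -
          have "\<lfloor>real D * (X f - X f0) $ j\<rfloor> = \<lfloor>real D * (X f' - X f0) $ j\<rfloor>"
            using fun_cong[OF g_eq, of j] that by (simp add: g_def)
          then have "\<bar>real D * (X f - X f0) $ j - real D * (X f' - X f0) $ j\<bar> \<le> 1" by linarith
          moreover have "real D * (X f - X f0) $ j - real D * (X f' - X f0) $ j = real D * z $ j"
            by (simp add: z_def algebra_simps)
          ultimately show ?thesis
            using D by (simp add: abs_mult field_simps)
        qed
        \<comment> \<open>Orthogonality and the maximality of \<open>v $ i\<close> bound the missing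
          coordinate by \<open>(d - 1) / D\<close>, which is below \<open>\<delta>\<close> since
          \<open>d \<le> D * \<delta>\<close>; thus \<open>z\<close> is too short to be
          nonzero.\<close>
        have "v $ i * z $ i = - (\<Sum>j\<in>UNIV - {i}. v $ j * z $ j)"
          using \<open>v \<bullet> z = 0\<close> by (simp add: inner_vec_def sum.remove[of UNIV i])
        then have "\<bar>v $ i\<bar> * \<bar>z $ i\<bar> = \<bar>\<Sum>j\<in>UNIV - {i}. v $ j * z $ j\<bar>"
          by (simp flip: abs_mult)
        also have "\<dots> \<le> (\<Sum>j\<in>UNIV - {i}. \<bar>v $ i\<bar> * (1 / real D))"
          by (rule order_trans[OF sum_abs])
            (intro sum_mono, unfold abs_mult, intro mult_mono i zj, auto)
        also have "\<dots> = \<bar>v $ i\<bar> * ((real d - 1) / real D)"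
          using d2 by (simp add: card_Diff_singleton card_mn of_nat_diff del: card_sum card_UNIV_sum)
        finally have "\<bar>z $ i\<bar> \<le> (real d - 1) / real D"
          using vi by (rule mult_left_le_imp_le)
        moreover have "1 / real D \<le> (real d - 1) / real D"
          using d2 D by (intro divide_right_mono) auto
        ultimately have "\<bar>z $ j\<bar> \<le> (real d - 1) / real D" for j
          using zj[of j] by (cases "j = i") auto
        then have "infnorm z \<le> (real d - 1) / real D"
          by (simp add: infnorm_cart_le)
        also have "\<dots> < \<delta>"
          using D by (simp add: divide_less_eq mult.commute)
        finally have "z = 0"
          using bspec[OF sep X_diff[of f f']] unfolding z_def[symmetric] by linarith
        then have "f j = f' j" for j
          using XInr[of f j] XInr[of f' j] by (simp add: z_def)
        then show "f = f'" by blast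
      qed
    qed
    also have "\<dots> = G"
    proof -
      have "card {- int (R * D)..int (R * D)} = 2 * R * D + 1"
        unfolding card_atLeastAtMost_int by (simp only: nat_eq_iff) simp
      moreover have "card (UNIV - {i}) = d - 1"
        by (simp add: card_Diff_singleton card_mn del: card_sum)
      ultimately show ?thesis
        by (simp add: G_def card_PiE)
    qed
    finally show ?thesis .
  next
    case True
    then show ?thesis by (simp only: card.empty zero_le)
  qed

  have fin: "finite T" "finite C"
    unfolding T_def C_def by (intro finite_PiE; simp)+
  \<comment> \<open>Double count: \<open>T\<close> is distributed over the cells in
    \<open>C\<close>, each holding at most \<open>G\<close> points.\<close>
  have "(N + 1) ^ CARD('n) = card T"
    by (simp add: T_def card_PiE)
  also have "card T \<le> card (\<Union>c\<in>C. {f \<in> T. cell f = c})"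
    using cell_mem fin by (intro card_mono) auto
  also have "\<dots> \<le> (\<Sum>c\<in>C. card {f \<in> T. cell f = c})"
    by (rule card_UN_le[OF fin(2)])
  also have "\<dots> \<le> card C * G"
    using fibre sum_bounded_above[of C "\<lambda>c. card {f \<in> T. cell f = c}" G] by simp
  also have "card C = (M + 1) ^ CARD('m)"
    by (simp add: C_def card_PiE)
  finally have "real ((N + 1) ^ CARD('n)) \<le> real ((M + 1) ^ CARD('m) * G)"
    by (rule of_nat_mono)
  moreover have "(real R * 2 ^ k) ^ CARD('n) \<le> real ((N + 1) ^ CARD('n))"
    unfolding of_nat_power by (intro power_mono) (auto simp: N_def)
  \<comment> \<open>The summands 1 are absorbed into the factors 2 and 3, using
    \<open>R \<le> s\<close> and \<open>1 \<le> R * D\<close>.\<close>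
  moreover have "real ((M + 1) ^ CARD('m) * G) \<le> (2 * s / real R) ^ CARD('m) * (3 * real R * real D) ^ (d - 1)"
  proof -
    have "1 \<le> s / real R" using s \<open>0 < R\<close> by (simp add: le_divide_eq)
    then have "real (M + 1) \<le> 2 * s / real R" unfolding M_def by linarith
    moreover have "1 \<le> R * D" using \<open>0 < R\<close> D by (simp add: Suc_leI)
    then have "2 * R * D + 1 \<le> 3 * R * D" by linarith
    then have "real (2 * R * D + 1) \<le> real (3 * R * D)" by (rule of_nat_mono)
    ultimately show ?thesis
      unfolding of_nat_mult of_nat_power G_def by (intro mult_mono power_mono) (use s in auto)
  qed
  ultimately have "(real R * 2 ^ k) ^ CARD('n) \<le> (2 * s / real R) ^ CARD('m) * (3 * real R * real D) ^ (d - 1)"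
    by linarith
  \<comment> \<open>The flow preserves volume, so the powers of \<open>2 ^ k\<close> cancel on both
    sides and a bound on \<open>R\<close> independent of \<open>k\<close> remains.\<close>
  moreover have "s ^ CARD('m) = (2 ^ k) ^ CARD('n)"
  proof -
    have "s ^ CARD('m) = 2 powr (real (k * CARD('n)))"
      by (simp add: s_def powr_power)
    also have "\<dots> = (2 ^ k) ^ CARD('n)"
      by (subst powr_realpow) (simp_all add: power_mult)
    finally show ?thesis .
  qed
  ultimately have "real R ^ CARD('n) * (2 ^ k) ^ CARD('n)
      \<le> (2 ^ CARD('m) * (3 * real D) ^ (d - 1) * real R ^ (d - 1) / real R ^ CARD('m)) * (2 ^ k) ^ CARD('n)"
    by (simp add: power_mult_distrib power_divide mult_ac)
  then have "real R ^ CARD('n) \<le> 2 ^ CARD('m) * (3 * real D) ^ (d - 1) * real R ^ (d - 1) / real R ^ CARD('m)"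
    by (rule mult_right_le_imp_le) simp
  then have "real R ^ CARD('n) * real R ^ CARD('m) \<le> 2 ^ CARD('m) * (3 * real D) ^ (d - 1) * real R ^ (d - 1)"
    using \<open>0 < R\<close> by (simp add: le_divide_eq)
  also have "real R ^ CARD('n) * real R ^ CARD('m) = real R * real R ^ (d - 1)"
    using d2 unfolding power_add[symmetric] power_Suc[symmetric] by (simp add: d_def add.commute)
  finally have "real R \<le> 2 ^ CARD('m) * (3 * real D) ^ (d - 1)"
    using \<open>0 < R\<close> by (simp add: mult_le_cancel_right)
  then have "real R \<le> real (2 ^ CARD('m) * (3 * D) ^ (d - 1))" by simp
  with R show False by linarith
qed

text \<open>Expand \<open>y\<close> in a basis of short lattice vectors and round the coefficients
  down: the error is a sum of \<open>m + n\<close> vectors of norm at most \<open>R\<close> with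
  coefficients in [0,1).\<close>

lemma flow_lattice_covering:
  fixes A :: "real^'n^'m"
  assumes "span {x \<in> flow_lattice k A. infnorm x \<le> R} = UNIV"
  obtains x where "x \<in> flow_lattice k A" "infnorm (y - x) \<le> (real CARD('m) + real CARD('n)) * R"
proof -
  let ?S = "{x \<in> flow_lattice k A. infnorm x \<le> R}"
  obtain B where B: "B \<subseteq> ?S" "independent B" "?S \<subseteq> span B"
    by (rule maximal_independent_subset)
  then have sp: "span B = UNIV"
    using span_minimal[OF B(3) subspace_span] assms by blast
  have fin: "finite B" using B(2) by (rule finiteI_independent)
  have card: "card B = CARD('m) + CARD('n)"
    using dim_span_eq_card_independent[OF B(2)] by (simp add: sp)
  have "y \<in> range (\<lambda>u. \<Sum>b\<in>B. u b *\<^sub>R b)"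
    using sp unfolding span_finite[OF fin] by simp
  then obtain u where u: "y = (\<Sum>b\<in>B. u b *\<^sub>R b)" by blast
  define x where "x = (\<Sum>b\<in>B. of_int \<lfloor>u b\<rfloor> *\<^sub>R b)"
  have "x \<in> flow_lattice k A"
    unfolding x_def using B by (intro flow_lattice_sum flow_lattice_scale) auto
  moreover have "infnorm (y - x) \<le> (real CARD('m) + real CARD('n)) * R"
    unfolding infnorm_cart_le
  proof
    fix i
    have "(y - x) $ i = (\<Sum>b\<in>B. frac (u b) * b $ i)"
      by (simp add: u x_def frac_def left_diff_distrib flip: sum_subtractf)
    also have "\<bar>\<dots>\<bar> \<le> (\<Sum>b\<in>B. 1 * R)"
    proof (rule order_trans[OF sum_abs], rule sum_mono)
      fix b assume "b \<in> B"
      then have "\<bar>b $ i\<bar> \<le> R" using B component_le_infnorm_cart[of b i] by fastforce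
      then show "\<bar>frac (u b) * b $ i\<bar> \<le> 1 * R"
        unfolding abs_mult using frac_lt_1[of "u b"] by (intro mult_mono) auto
    qed
    finally show "\<bar>(y - x) $ i\<bar> \<le> (real CARD('m) + real CARD('n)) * R"
      by (simp add: card)
  qed
  ultimately show ?thesis using that by blast
qed

lemma filterlim_expansion_factor:
  "filterlim (\<lambda>k. 2 powr (real k * real CARD('n::finite) / real CARD('m::finite))) at_top sequentially"
proof -
  have "filterlim (\<lambda>k. real k * (real CARD('n) / real CARD('m) * ln 2)) at_top sequentially"
    by (intro filterlim_at_top_mult_tendsto_pos[OF tendsto_const] filterlim_real_sequentially) auto
  then show ?thesis
    using filterlim_compose[OF exp_at_top] by (simp add: powr_def mult_ac)
qed

lemma nonsingular_frequently_covering: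
  fixes A :: "real^'n^'m"
  assumes "\<not> singular_matrix A"
  obtains C where "0 < C"
    "\<exists>\<^sub>F k in sequentially. \<forall>y. \<exists>x\<in>flow_lattice k A. infnorm (y - x) \<le> C"
proof -
  obtain \<delta> where \<delta>: "0 < \<delta>"
    "\<exists>\<^sub>F k in sequentially. \<forall>x\<in>flow_lattice k A. x \<noteq> 0 \<longrightarrow> \<delta> \<le> infnorm x"
    using nonsingular_frequently_separated[OF assms] .
  let ?d = "CARD('m) + CARD('n)"
  \<comment> \<open>\<open>D\<close> depends only on \<open>\<delta>\<close> and the dimensions, and
    \<open>R\<close> only on \<open>D\<close> and the dimensions, so the covering constant is the
    same for all these \<open>k\<close>.\<close>
  define D where "D = Suc (nat \<lceil>real ?d / \<delta>\<rceil>)"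
  have "real ?d / \<delta> \<le> real D" unfolding D_def by linarith
  then have D: "0 < D" "real ?d \<le> real D * \<delta>"
    using \<delta> by (simp_all add: D_def divide_le_eq)
  define R where "R = Suc (2 ^ CARD('m) * (3 * D) ^ (?d - 1))"
  have "\<forall>\<^sub>F k in sequentially. real R \<le> 2 powr (real k * real CARD('n) / real CARD('m))"
    using filterlim_expansion_factor unfolding filterlim_at_top by blast
  with \<delta>(2) have "\<exists>\<^sub>F k in sequentially. (\<forall>x\<in>flow_lattice k A. x \<noteq> 0 \<longrightarrow> \<delta> \<le> infnorm x) \<and>
      real R \<le> 2 powr (real k * real CARD('n) / real CARD('m))"
    by (rule frequently_eventually_frequently)
  then have "\<exists>\<^sub>F k in sequentially. \<forall>y. \<exists>x\<in>flow_lattice k A. infnorm (y - x) \<le> real ?d * real R"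
  proof (rule frequently_elim1, intro allI)
    fix k and y :: "real^('m + 'n)"
    assume k: "(\<forall>x\<in>flow_lattice k A. x \<noteq> 0 \<longrightarrow> \<delta> \<le> infnorm x) \<and>
      real R \<le> 2 powr (real k * real CARD('n) / real CARD('m))"
    have "span {x \<in> flow_lattice k A. infnorm x \<le> real R} = UNIV"
      by (rule span_small_flow_lattice[OF conjunct1[OF k] D _ conjunct2[OF k]]) (simp add: R_def)
    then show "\<exists>x\<in>flow_lattice k A. infnorm (y - x) \<le> real ?d * real R"
      using flow_lattice_covering[of k A "real R" y] by auto
  qed
  moreover have "0 < real ?d * real R"
    by (intro mult_pos_pos) (simp_all only: of_nat_0_less_iff R_def, simp_all)
  ultimately show ?thesis using that by blast
qed

subsection \<open>Porosity of the badly approximable targets\<close>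

text \<open>A uniform version of a positive liminf, with explicit threshold \<open>N\<close> and
  lower bound \<open>\<eta>\<close>. Quantifying over every \<open>p\<close> instead of using the
  distance to the integer vectors exhibits the set as an intersection of closed conditions.\<close>

definition bad_cut :: "real^'n^'m \<Rightarrow> real \<Rightarrow> real \<Rightarrow> (real^'m) set" where
  "bad_cut A N \<eta> = {b. \<forall>p\<in>int_vecs. \<forall>q\<in>int_vecs. N \<le> infnorm q \<longrightarrow>
     \<eta> \<le> infnorm q powr (real CARD('n) / real CARD('m)) * infnorm (p + A *v q - b)}"

lemma closed_bad_cut:
  fixes A :: "real^'n^'m"
  shows "closed (bad_cut A N \<eta>)"
proof -
  have "closed {b. \<eta> \<le> c * infnorm (a - b)}" for c and a :: "real^'m"
    by (intro closed_Collect_le continuous_intros)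
  moreover have "bad_cut A N \<eta> = (\<Inter>p\<in>int_vecs. \<Inter>q\<in>{q\<in>int_vecs. N \<le> infnorm q}.
      {b. \<eta> \<le> infnorm q powr (real CARD('n) / real CARD('m)) * infnorm (p + A *v q - b)})"
    unfolding bad_cut_def by blast
  ultimately show ?thesis by (simp only:) (intro closed_INT ballI)
qed

text \<open>At a scale where \<open>flow_lattice k A\<close> is \<open>C\<close>-dense, every ball of radius comparable to
  \<open>2\<^sup>-\<^sup>k\<^sup>n\<^sup>/\<^sup>m\<close> contains a point \<open>p + A q\<close> with \<open>|q|\<close> comparable to \<open>2\<^sup>k\<close>, and a
  proportional ball around that point misses the set.\<close>

lemma negligible_bad_cut:
  fixes A :: "real^'n^'m"
  assumes A: "\<not> singular_matrix A" and \<eta>: "0 < \<eta>"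
  shows "negligible (bad_cut A N \<eta>)"
proof -
  obtain C where C: "0 < C"
    "\<exists>\<^sub>F k in sequentially. \<forall>y. \<exists>x\<in>flow_lattice k A. infnorm (y - x) \<le> C"
    using nonsingular_frequently_covering[OF A] .
  let ?e = "real CARD('n) / real CARD('m)"
  define s where "s k = 2 powr (real k * real CARD('n) / real CARD('m))" for k
  \<comment> \<open>Below, \<open>infnorm q \<le> (2 * C + 1) * 2 ^ k\<close>, so
    \<open>\<kappa> / s k\<close> is the radius within which the product falls below
    \<open>\<eta>\<close>. In \<open>w\<close>, \<open>sqrt CARD('m)\<close> converts sup-norm
    distance to Euclidean distance and the summand \<open>\<kappa>\<close> makes room for the
    hole.\<close>
  define \<kappa> where "\<kappa> = \<eta> / (2 * C + 1) powr ?e"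
  define w where "w = sqrt CARD('m) * C + \<kappa>"
  have s_pos: "0 < s k" for k by (simp add: s_def)
  have \<kappa>: "0 < \<kappa>" using \<eta> C by (simp add: \<kappa>_def)
  have w: "0 < w" "\<kappa> \<le> w" using \<kappa> C by (simp_all add: w_def add_nonneg_pos)
  show ?thesis
  proof (rule porous_negligible)
    show "bad_cut A N \<eta> \<in> sets lebesgue"
      using borel_closed[OF closed_bad_cut] by (intro sets_completionI_sets) simp
    show "0 < \<kappa> / w" using \<kappa> w by simp
    fix b and \<epsilon> :: real assume "0 < \<epsilon>"
    have "\<forall>\<^sub>F k in sequentially. w / \<epsilon> < s k"
      using filterlim_expansion_factor[where 'm='m and 'n='n] unfolding s_def filterlim_at_top_dense by blast
    moreover have "\<forall>\<^sub>F k in sequentially. N \<le> 2 ^ k"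
    proof -
      obtain k0 where k0: "N < 2 ^ k0" using real_arch_pow[of 2 N] by auto
      show ?thesis
      proof (rule eventually_sequentiallyI[of k0])
        fix k assume "k0 \<le> k"
        then have "(2 :: real) ^ k0 \<le> 2 ^ k" by (intro power_increasing) auto
        with k0 show "N \<le> 2 ^ k" by linarith
      qed
    qed
    ultimately have "\<forall>\<^sub>F k in sequentially. w / \<epsilon> < s k \<and> N \<le> 2 ^ k"
      by (rule eventually_conj)
    from frequently_eventually_frequently[OF C(2) this]
    obtain k where k: "w / \<epsilon> < s k" "N \<le> 2 ^ k"
      and cov: "\<And>y. \<exists>x\<in>flow_lattice k A. infnorm (y - x) \<le> C"
      using frequently_ex by blast
    \<comment> \<open>The lower coordinates \<open>C + 1\<close> force each
      \<open>q $ j / 2 ^ k\<close> into the interval from 1 to \<open>2 * C + 1\<close>, so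
      \<open>q\<close> is both large and comparable to \<open>2 ^ k\<close>.\<close>
    define y :: "real^('m + 'n)" where
      "y = (\<chi> l. case l of Inl i \<Rightarrow> s k * b $ i | Inr j \<Rightarrow> C + 1)"
    obtain p q where pq: "p \<in> int_vecs" "q \<in> int_vecs" "infnorm (y - flow_point k A p q) \<le> C"
      using cov[of y] by (auto simp: flow_lattice_eq)
    have q: "\<bar>C + 1 - q $ j / 2 ^ k\<bar> \<le> C" for j
      using component_le_infnorm_cart[of "y - flow_point k A p q" "Inr j"] pq(3) by (simp add: y_def)
    have q_lower: "2 ^ k \<le> q $ j" for j
    proof -
      have "1 \<le> q $ j / 2 ^ k" using q[of j] by linarith
      then show ?thesis by (simp add: le_divide_eq)
    qed
    \<comment> \<open>Here \<open>undefined\<close> is just some index of the nonempty type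
      \<open>'n\<close>.\<close>
    then have "2 ^ k \<le> infnorm q"
      using component_le_infnorm_cart[of q undefined] q_lower[of undefined] by linarith
    have "\<bar>q $ j\<bar> \<le> (2 * C + 1) * 2 ^ k" for j
    proof -
      have "q $ j / 2 ^ k \<le> 2 * C + 1" using q[of j] by linarith
      then have "q $ j \<le> (2 * C + 1) * 2 ^ k" by (simp add: divide_le_eq)
      moreover have "0 \<le> q $ j" using q_lower[of j] by (meson order_trans zero_le_numeral zero_le_power)
      ultimately show ?thesis by simp
    qed
    then have "infnorm q \<le> (2 * C + 1) * 2 ^ k"
      by (simp add: infnorm_cart_le)
    then have "infnorm q powr ?e \<le> ((2 * C + 1) * 2 ^ k) powr ?e"
      by (intro powr_mono2) (auto simp: infnorm_pos_le)
    also have "\<dots> = (2 * C + 1) powr ?e * s k"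
      using C by (simp add: powr_mult s_def powr_powr flip: powr_realpow)
    finally have q_powr: "infnorm q powr ?e \<le> (2 * C + 1) powr ?e * s k" .
    define z where "z = p + A *v q"
    have "\<bar>(z - b) $ i\<bar> \<le> C / s k" for i
    proof -
      have "\<bar>s k * b $ i - s k * z $ i\<bar> \<le> C"
        using component_le_infnorm_cart[of "y - flow_point k A p q" "Inl i"] pq(3)
        by (simp add: y_def s_def z_def)
      then have "s k * \<bar>(z - b) $ i\<bar> \<le> C"
        using s_pos[of k] by (simp add: abs_mult abs_minus_commute flip: right_diff_distrib)
      then show ?thesis using s_pos[of k] by (simp add: le_divide_eq mult.commute)
    qed
    then have "infnorm (z - b) \<le> C / s k" by (simp add: infnorm_cart_le)
    then have "sqrt CARD('m) * infnorm (z - b) \<le> sqrt CARD('m) * (C / s k)"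
      by (intro mult_left_mono) auto
    then have dist_zb: "dist b z \<le> sqrt CARD('m) * C / s k"
      using norm_le_infnorm[of "z - b"] by (simp add: dist_norm norm_minus_commute)
    have scale: "\<kappa> / w * (w / s k) = \<kappa> / s k" using w by simp
    have "ball z (\<kappa> / s k) \<subseteq> ball b (w / s k)"
    proof
      fix x assume "x \<in> ball z (\<kappa> / s k)"
      then have "dist b x < sqrt CARD('m) * C / s k + \<kappa> / s k"
        using dist_triangle[of b x z] dist_zb by simp
      then show "x \<in> ball b (w / s k)" by (simp add: w_def add_divide_distrib)
    qed
    moreover have "x \<notin> bad_cut A N \<eta>" if x: "x \<in> ball z (\<kappa> / s k)" for x
    proof -
      have "infnorm (z - x) < \<kappa> / s k"
        using x infnorm_le_norm[of "z - x"] by (simp add: dist_norm)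
      then have "(2 * C + 1) powr ?e * s k * infnorm (z - x) < (2 * C + 1) powr ?e * s k * (\<kappa> / s k)"
        using C s_pos[of k] by (intro mult_strict_left_mono) auto
      also have "\<dots> = \<eta>"
        using C s_pos[of k] by (simp add: \<kappa>_def)
      finally have "infnorm q powr ?e * infnorm (z - x) < \<eta>"
        using mult_right_mono[OF q_powr infnorm_pos_le[of "z - x"]] by linarith
      moreover have "N \<le> infnorm q" using k \<open>2 ^ k \<le> infnorm q\<close> by linarith
      ultimately show ?thesis
        using pq unfolding bad_cut_def z_def by (auto simp: not_le)
    qed
    ultimately have "ball z (\<kappa> / w * (w / s k)) \<subseteq> ball b (w / s k) \<and>
        ball z (\<kappa> / w * (w / s k)) \<inter> bad_cut A N \<eta> = {}"
      unfolding scale by blast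
    moreover have "0 < w / s k" "w / s k < \<epsilon>"
      using w s_pos[of k] k(1) \<open>0 < \<epsilon>\<close> by (simp_all add: divide_less_eq mult.commute)
    ultimately show "\<exists>r z. 0 < r \<and> r < \<epsilon> \<and> ball z (\<kappa> / w * r) \<subseteq> ball b r \<and>
        ball z (\<kappa> / w * r) \<inter> bad_cut A N \<eta> = {}"
      by blast
  qed
qed

section \<open>Passage from the cut sets to the torus\<close>

lemma inhom_const_to_torus:
  fixes A :: "real^'n^'m"
  shows "inhom_const A (to_torus b) = Liminf (inf (filtercomap infnorm at_top) (principal int_vecs))
     (\<lambda>q. ennreal (infnorm q powr (real CARD('n) / real CARD('m)) * dist_int_vecs (A *v q - b)))"
  by transfer simp

text \<open>A positive liminf exceeds some positive real \<open>r\<close>, so the product exceeds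
  \<open>r\<close> from some norm on; rounding the threshold up to a natural number and
  \<open>r\<close> down to a reciprocal makes the union countable.\<close>

lemma Bad_subset_bad_cut:
  fixes A :: "real^'n^'m"
  shows "to_torus -` Bad A \<subseteq> (\<Union>N::nat. \<Union>j::nat. bad_cut A (real N) (inverse (real (Suc j))))"
proof
  fix b assume "b \<in> to_torus -` Bad A"
  then have "0 < inhom_const A (to_torus b)" by (simp add: Bad_def)
  then obtain y where y: "0 < y" "y < inhom_const A (to_torus b)" using dense by blast
  then have "y < top" using less_top by (metis order.strict_trans2 top_greatest)
  then obtain r where r: "y = ennreal r" "0 < r"
    using y by (metis ennreal_enn2real enn2real_positive_iff)
  obtain j where j: "inverse (real (Suc j)) < r"
    using reals_Archimedean[OF r(2)] by blast
  have "\<forall>\<^sub>F q in inf (filtercomap infnorm at_top) (principal int_vecs).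
      y < ennreal (infnorm q powr (real CARD('n) / real CARD('m)) * dist_int_vecs (A *v q - b))"
    using y(2) unfolding inhom_const_to_torus by (rule less_LiminfD)
  then obtain N0 where N0: "\<And>q. N0 \<le> infnorm q \<Longrightarrow> q \<in> int_vecs \<Longrightarrow>
      y < ennreal (infnorm q powr (real CARD('n) / real CARD('m)) * dist_int_vecs (A *v q - b))"
    unfolding eventually_inf_principal eventually_filtercomap_at_top_linorder by blast
  obtain N where N: "N0 \<le> real N" using real_arch_simple by blast
  have "b \<in> bad_cut A (real N) (inverse (real (Suc j)))"
    unfolding bad_cut_def
  proof (intro CollectI ballI impI)
    fix p :: "real^'m" and q :: "real^'n"
    assume pq: "p \<in> int_vecs" "q \<in> int_vecs" "real N \<le> infnorm q"
    let ?c = "infnorm q powr (real CARD('n) / real CARD('m))"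
    have "ennreal r < ennreal (?c * dist_int_vecs (A *v q - b))"
      using N0[of q] pq N r by simp
    then have "r < ?c * dist_int_vecs (A *v q - b)"
      using r by (simp add: ennreal_less_iff)
    also have "\<dots> \<le> ?c * infnorm (p + A *v q - b)"
      using dist_int_vecs_le[OF int_vecs_minus[OF pq(1)], of "A *v q - b"]
      by (intro mult_left_mono) (simp_all add: algebra_simps)
    finally show "inverse (real (Suc j)) \<le> ?c * infnorm (p + A *v q - b)"
      using j by linarith
  qed
  then show "b \<in> (\<Union>N::nat. \<Union>j::nat. bad_cut A (real N) (inverse (real (Suc j))))" by blast
qed

theorem corollary2p4:
  fixes A :: "real^'n^'m"
  assumes "\<not> singular_matrix A"
  shows "(\<Sum>k. ennreal (Delta (Suc k) A)) = \<infinity>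
    \<and> Bad A \<in> null_sets torus_lebesgue
    \<and> (AE b in torus_lebesgue. inhom_const A b = 0)"
proof (intro conjI)
  show "(\<Sum>k. ennreal (Delta (Suc k) A)) = \<infinity>"
    using assms by (rule sum_Delta_infinite)
  have "negligible (\<Union>N::nat. \<Union>j::nat. bad_cut A (real N) (inverse (real (Suc j))))"
    by (intro negligible_Union_nat negligible_bad_cut assms) simp
  then have neg: "negligible (to_torus -` Bad A)"
    using Bad_subset_bad_cut by (rule negligible_subset)
  \<comment> \<open>Measurability comes from completeness of Lebesgue measure: the preimage lies in
    a negligible set.\<close>
  then have sets: "Bad A \<in> sets torus_lebesgue"
    by (simp add: sets_torus_lebesgue negligible_imp_sets)
  have "negligible (to_torus -` Bad A \<inter> unit_cell)"
    using neg by (rule negligible_subset) blast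
  then have "emeasure lebesgue (to_torus -` Bad A \<inter> unit_cell) = 0"
    by (meson negligible_iff_emeasure0 negligible_imp_sets)
  then show null: "Bad A \<in> null_sets torus_lebesgue"
    using sets by (simp add: null_sets_def emeasure_torus_lebesgue)
  show "AE b in torus_lebesgue. inhom_const A b = 0"
    using AE_not_in[OF null] by (rule AE_mp) (simp add: Bad_def)
qed

end
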